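(* Let $U$ be an $(n-1)$-dimensional submanifold of $\mathbb{R}^n$, and let $\Omega\subset\mathbb{R}^n-U$ be a subset. Let $L$ be a straight line that intersects $U$ transversely at an interior point $u$ of $U$. Suppose there are a point $p\in L\cap\Omega$ and an open interval $I\subset L\cap\Omega$ such that $p$ and $I$ lie in different components of $L-\{u\}$. Then there is a function $\Omega\to\mathbb{R}$ that is locally convex but not convex.
   Context: All functions are real valued. For a function $f$ on a (not necessarily convex) set $S\subset\mathbb{R}^n$: $f$ is convex if $f(x)\le \lambda_1 f(x_1)+\cdots+\lambda_k f(x_k)$ whenever $x_1,\dots,x_k\in S$, $\lambda_i\ge 0$, $\lambda_1+\cdots+\lambda_k=1$, and $x=\lambda_1x_1+\cdots+\lambda_kx_k$ also lies in $S$; $f$ is locally convex if for every $x\in S$ there is a ball $B$ around $x$ such that the restriction of $f$ to $B\cap S$ is convex in the previous sense. An open interval in $L$ is a nonempty, relatively open line segment of $L$. *)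

theory Defs
  imports "HOL-Analysis.Analysis"
begin

text \<open>
  Convexity of a function on a set that need not be convex. The library's
  \<open>convex_on\<close> is not used since it requires the set itself to be convex.
\<close>

definition convex_fun_on :: "'a::real_vector set \<Rightarrow> ('a \<Rightarrow> real) \<Rightarrow> bool" where
  "convex_fun_on S f \<longleftrightarrow>
    (\<forall>k::nat. \<forall>x c.
      (\<forall>i\<in>{1..k}. x i \<in> S \<and> 0 \<le> c i) \<and> (\<Sum>i=1..k. c i) = 1 \<and>
      (\<Sum>i=1..k. c i *\<^sub>R x i) \<in> S \<longrightarrow>
      f (\<Sum>i=1..k. c i *\<^sub>R x i) \<le> (\<Sum>i=1..k. c i * f (x i)))"

definition locally_convex_fun_on :: "'a::real_normed_vector set \<Rightarrow> ('a \<Rightarrow> real) \<Rightarrow> bool" where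
  "locally_convex_fun_on S f \<longleftrightarrow> (\<forall>x\<in>S. \<exists>r>0. convex_fun_on (ball x r \<inter> S) f)"

definition open_interval_of :: "'a::euclidean_space set \<Rightarrow> 'a set \<Rightarrow> bool" where
  "open_interval_of L I \<longleftrightarrow> (\<exists>a\<in>L. \<exists>b\<in>L. a \<noteq> b \<and> I = open_segment a b)"

definition C1_on :: "'a::real_normed_vector set \<Rightarrow> ('a \<Rightarrow> 'b::real_normed_vector) \<Rightarrow> bool" where
  "C1_on W f \<longleftrightarrow>
    (\<exists>f'. (\<forall>x\<in>W. (f has_derivative blinfun_apply (f' x)) (at x)) \<and> continuous_on W f')"

definition C1_diffeomorphism ::
  "'a::real_normed_vector set \<Rightarrow> 'a set \<Rightarrow> ('a \<Rightarrow> 'a) \<Rightarrow> ('a \<Rightarrow> 'a) \<Rightarrow> bool" where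
  "C1_diffeomorphism W V \<phi> \<psi> \<longleftrightarrow>
    open W \<and> open V \<and> homeomorphism W V \<phi> \<psi> \<and> C1_on W \<phi> \<and> C1_on V \<psi>"

text \<open>
  Embedded submanifolds, possibly with boundary, by slice charts: near an interior
  point an ambient diffeomorphism carries \<open>U\<close> to a \<open>d\<close>-dimensional linear subspace
  \<open>S\<close>; near a boundary point it carries \<open>U\<close> to a closed half-space of \<open>S\<close>, and the
  point itself to the bounding hyperplane of that half-space. The regularity is
  \<open>C\<^sup>1\<close>, the least for which tangent spaces make sense, so that smoother
  submanifolds are included.
\<close>

definition manifold_interior :: "nat \<Rightarrow> 'a::euclidean_space set \<Rightarrow> 'a set" where
  "manifold_interior d U =
    {x \<in> U. \<exists>W V \<phi> \<psi> S. C1_diffeomorphism W V \<phi> \<psi> \<and> x \<in> W \<and>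
       subspace S \<and> dim S = d \<and> \<phi> ` (U \<inter> W) = S \<inter> V}"

definition manifold_boundary :: "nat \<Rightarrow> 'a::euclidean_space set \<Rightarrow> 'a set" where
  "manifold_boundary d U =
    {x \<in> U. \<exists>W V \<phi> \<psi> S a. C1_diffeomorphism W V \<phi> \<psi> \<and> x \<in> W \<and>
       subspace S \<and> dim S = d \<and> a \<in> S \<and> a \<noteq> 0 \<and> a \<bullet> \<phi> x = 0 \<and>
       \<phi> ` (U \<inter> W) = {y \<in> S. 0 \<le> a \<bullet> y} \<inter> V}"

definition submanifold :: "nat \<Rightarrow> 'a::euclidean_space set \<Rightarrow> bool" where
  "submanifold d U \<longleftrightarrow> U = manifold_interior d U \<union> manifold_boundary d U"

text \<open>
  Velocities at \<open>x\<close> of curves in \<open>A\<close>. This is the usual tangent space of a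
  submanifold at an interior point; at a boundary point, which is not needed
  here, it would only give the vectors tangent to the boundary.
\<close>

definition tangent_space :: "'a::real_normed_vector set \<Rightarrow> 'a \<Rightarrow> 'a set" where
  "tangent_space A x =
    {v. \<exists>\<gamma> e. 0 < e \<and> (\<forall>t\<in>{-e<..<e}. \<gamma> t \<in> A) \<and> \<gamma> 0 = x \<and>
       (\<gamma> has_vector_derivative v) (at 0)}"

definition transverse_at :: "'a::real_normed_vector set \<Rightarrow> 'a set \<Rightarrow> 'a \<Rightarrow> bool" where
  "transverse_at A B x \<longleftrightarrow> x \<in> A \<inter> B \<and>
    {v + w | v w. v \<in> tangent_space A x \<and> w \<in> tangent_space B x} = UNIV"

end

theory Submission
  imports Defs
begin

text \<open>
  Let \<open>q\<close> be the distance to \<open>L\<close>. Near \<open>u\<close> the hypersurface \<open>U\<close> is the zero set of a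
  function \<open>h\<close> whose derivative at \<open>u\<close> does not vanish along \<open>L\<close>, so for small \<open>r\<close> it
  contains a wall across the cylinder \<open>q \<le> r\<close> that leaves \<open>p\<close> and \<open>I\<close> on different
  sides. Let \<open>f = r\<close> on the part of the cylinder on the side of \<open>I\<close>, and \<open>f = q\<close> elsewhere.
  Away from the wall, \<open>f\<close> agrees locally with one of the convex functions \<open>q\<close> and
  \<open>max q r\<close>. But \<open>f\<close> vanishes at \<open>p\<close> and equals \<open>r > 0\<close> on \<open>I\<close>, so it is not convex.
\<close>

section \<open>Convexity on arbitrary sets\<close>

lemma convex_fun_on_cong_convex_on:
  assumes g: "convex_on UNIV g" and fg: "\<And>x. x \<in> S \<Longrightarrow> f x = g x"
  shows "convex_fun_on S f"
  unfolding convex_fun_on_def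
proof (intro allI impI, elim conjE)
  fix k :: nat and x c
  assume xc: "\<forall>i\<in>{1..k}. x i \<in> S \<and> 0 \<le> c i" and s: "(\<Sum>i=1..k. c i) = 1"
    and S: "(\<Sum>i=1..k. c i *\<^sub>R x i) \<in> S"
  \<comment> \<open>For \<open>k = 0\<close> the weights would sum to 0; Jensen's inequality for
    \<open>g\<close> needs a nonempty index set.\<close>
  have "{1..k} \<noteq> {}" using s by (metis sum.empty zero_neq_one)
  then have "g (\<Sum>i=1..k. c i *\<^sub>R x i) \<le> (\<Sum>i=1..k. c i * g (x i))"
    using xc s by (intro convex_on_sum[OF _ _ g]) auto
  also have "\<dots> = (\<Sum>i=1..k. c i * f (x i))"
    using xc fg by (intro sum.cong) auto
  finally show "f (\<Sum>i=1..k. c i *\<^sub>R x i) \<le> (\<Sum>i=1..k. c i * f (x i))"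
    using fg S by simp
qed

lemma convex_fun_onD:
  assumes "convex_fun_on S f" "x \<in> S" "y \<in> S" "0 \<le> t" "t \<le> 1"
    and "(1 - t) *\<^sub>R x + t *\<^sub>R y \<in> S"
  shows "f ((1 - t) *\<^sub>R x + t *\<^sub>R y) \<le> (1 - t) * f x + t * f y"
proof -
  have two: "{Suc 0..2} = {1, 2}" by auto
  show ?thesis
    using assms(1)[unfolded convex_fun_on_def, rule_format,
        of 2 "\<lambda>i. if i = 1 then x else y" "\<lambda>i. if i = 1 then 1 - t else t"] assms(2-)
    by (simp add: two)
qed

lemma convex_on_max:
  fixes f g :: "'a::real_vector \<Rightarrow> real"
  assumes f: "convex_on S f" and g: "convex_on S g"
  shows "convex_on S (\<lambda>x. max (f x) (g x))"
proof (rule convex_onI)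
  fix t :: real and x y assume *: "0 < t" "t < 1" "x \<in> S" "y \<in> S"
  let ?R = "(1 - t) * max (f x) (g x) + t * max (f y) (g y)"
  have "(1 - t) * f x + t * f y \<le> ?R" "(1 - t) * g x + t * g y \<le> ?R"
    using * by (auto intro!: add_mono mult_left_mono)
  then show "max (f ((1 - t) *\<^sub>R x + t *\<^sub>R y)) (g ((1 - t) *\<^sub>R x + t *\<^sub>R y)) \<le> ?R"
    using convex_onD[OF f, of t x y] convex_onD[OF g, of t x y] * by simp
qed (rule convex_on_imp_convex[OF f])

section \<open>Tangent vectors and defining functions\<close>

text \<open>A curve in \<open>A\<close> through \<open>x\<close> stays in \<open>W\<close> for small
  times, so \<open>h\<close> vanishes along it there, and by the chain rule \<open>D v\<close> is
  the derivative of a constant. The codomain is general because both a scalar defining function of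
  \<open>U\<close> and a vector-valued one of \<open>L\<close> are treated this way.\<close>

lemma tangent_space_kernel:
  fixes h :: "'a::real_normed_vector \<Rightarrow> 'b::real_normed_vector"
  assumes v: "v \<in> tangent_space A x" and "open W" "x \<in> W"
    and h0: "\<And>y. y \<in> A \<inter> W \<Longrightarrow> h y = 0" and D: "(h has_derivative D) (at x)"
  shows "D v = 0"
proof -
  obtain \<gamma> e where e: "0 < e" and \<gamma>A: "\<forall>t\<in>{-e<..<e}. \<gamma> t \<in> A" and \<gamma>0: "\<gamma> 0 = x"
    and \<gamma>: "(\<gamma> has_vector_derivative v) (at 0)"
    using v unfolding tangent_space_def by blast
  have "((h \<circ> \<gamma>) has_vector_derivative D v) (at 0)"
    unfolding has_vector_derivative_def
    using diff_chain_at[OF \<gamma>[unfolded has_vector_derivative_def], of h D] D \<gamma>0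
    by (simp add: o_def linear_cmul[OF has_derivative_linear[OF D]])
  moreover have "\<forall>\<^sub>F t in nhds 0. (h \<circ> \<gamma>) t = 0"
  proof -
    have "isCont \<gamma> 0" using \<gamma> has_vector_derivative_continuous by blast
    then have "\<forall>\<^sub>F t in nhds 0. \<gamma> t \<in> W"
      using \<open>open W\<close> \<open>x \<in> W\<close> \<gamma>0
      by (auto simp: isCont_def tendsto_at_iff_tendsto_nhds dest: topological_tendstoD)
    moreover have "\<forall>\<^sub>F t in nhds 0. t \<in> {-e<..<e}"
      using e by (intro eventually_nhds_in_open) auto
    ultimately show ?thesis by eventually_elim (use \<gamma>A h0 in auto)
  qed
  then have "((h \<circ> \<gamma>) has_vector_derivative D v) (at 0) \<longleftrightarrow>
      ((\<lambda>_. 0) has_vector_derivative D v) (at 0)"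
    by (intro has_vector_derivative_cong_ev) (auto dest: eventually_nhds_x_imp_x elim: eventually_mono)
  ultimately show ?thesis
    using vector_derivative_unique_at has_vector_derivative_const by metis
qed

text \<open>A slice chart straightens \<open>U\<close> to a hyperplane; \<open>h\<close> is the
  inner product of the chart with a normal vector of that hyperplane.\<close>

lemma manifold_interior_defining_function:
  fixes U :: "'a::euclidean_space set"
  assumes "u \<in> manifold_interior (DIM('a) - 1) U"
  obtains W :: "'a set" and h :: "'a \<Rightarrow> real" and D where "open W" "u \<in> W" "continuous_on W h"
    "\<And>x. x \<in> W \<Longrightarrow> h x = 0 \<longleftrightarrow> x \<in> U" "(h has_derivative D) (at u)" "surj D"
proof -
  obtain W V \<phi> \<psi> S where diffeo: "C1_diffeomorphism W V \<phi> \<psi>" and uW: "u \<in> W"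
    and S: "subspace S" "dim S = DIM('a) - 1" and US: "\<phi> ` (U \<inter> W) = S \<inter> V"
    using assms unfolding manifold_interior_def by blast
  have W: "open W" and hom: "homeomorphism W V \<phi> \<psi>"
    using diffeo unfolding C1_diffeomorphism_def by auto
  obtain \<phi>' where \<phi>': "(\<phi> has_derivative \<phi>') (at u)"
    using diffeo uW unfolding C1_diffeomorphism_def C1_on_def by blast
  have \<phi>uV: "\<phi> u \<in> V" and \<psi>\<phi>: "\<psi> (\<phi> u) = u"
    using hom uW unfolding homeomorphism_def by auto
  then obtain \<psi>' where \<psi>': "(\<psi> has_derivative \<psi>') (at (\<phi> u))"
    using diffeo unfolding C1_diffeomorphism_def C1_on_def by blast
  \<comment> \<open>Differentiating \<open>\<phi> \<circ> \<psi>\<close>, the identity on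
    \<open>V\<close>, makes \<open>\<psi>'\<close> a right inverse of \<open>\<phi>'\<close>;
    surjectivity of \<open>?D\<close> rests on this.\<close>
  have "((\<phi> \<circ> \<psi>) has_derivative \<phi>' \<circ> \<psi>') (at (\<phi> u))"
    using diff_chain_at[OF \<psi>'] \<phi>' \<psi>\<phi> by simp
  then have "((\<lambda>y. y) has_derivative \<phi>' \<circ> \<psi>') (at (\<phi> u))"
  proof (rule has_derivative_transform_within_open)
    show "open V" using diffeo unfolding C1_diffeomorphism_def by auto
    show "\<And>y. y \<in> V \<Longrightarrow> (\<phi> \<circ> \<psi>) y = y" using hom unfolding homeomorphism_def by auto
  qed (rule \<phi>uV)
  then have inv: "\<phi>' \<circ> \<psi>' = (\<lambda>y. y)"
    using has_derivative_ident has_derivative_unique by blast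
  \<comment> \<open>A proper subspace lies in some hyperplane; since \<open>S\<close> has
    codimension one, it equals that hyperplane.\<close>
  have "dim S < DIM('a)" using S by simp
  then obtain a where a: "a \<noteq> 0" and "span S \<subseteq> {x. a \<bullet> x = 0}"
    using lowdim_subset_hyperplane by blast
  then have "S \<subseteq> {x. a \<bullet> x = 0}" using span_superset by blast
  then have Sa: "S = {x. a \<bullet> x = 0}"
    using S a by (intro subspace_dim_equal) (auto simp: subspace_hyperplane dim_hyperplane)
  let ?D = "\<lambda>v. a \<bullet> \<phi>' v"
  have D: "((\<lambda>x. a \<bullet> \<phi> x) has_derivative ?D) (at u)"
    by (intro has_derivative_inner_right \<phi>')
  have "surj ?D"
  proof (rule surjI)
    fix c
    show "?D (\<psi>' ((c / (a \<bullet> a)) *\<^sub>R a)) = c" using a fun_cong[OF inv] by simp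
  qed
  moreover have "continuous_on W (\<lambda>x. a \<bullet> \<phi> x)"
    using hom unfolding homeomorphism_def by (auto intro: continuous_intros)
  moreover have "a \<bullet> \<phi> x = 0 \<longleftrightarrow> x \<in> U" if x: "x \<in> W" for x
  proof
    assume "a \<bullet> \<phi> x = 0"
    then have "\<phi> x \<in> \<phi> ` (U \<inter> W)" using US Sa hom x unfolding homeomorphism_def by auto
    \<comment> \<open>Injectivity of \<open>\<phi>\<close> on \<open>W\<close> identifies
      \<open>x\<close> with the point of \<open>U\<close> that has the same image.\<close>
    then show "x \<in> U" using hom x unfolding homeomorphism_def by (metis IntE imageE)
  qed (use US Sa x in blast)
  ultimately show ?thesis using that[OF W uW] D by blast
qed

text \<open>\<open>D\<close> kills the tangent vectors of \<open>U\<close>, and those of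
  \<open>L\<close> are multiples of \<open>l\<close>. By transversality a vector with
  \<open>D\<close>-value 1 is a sum of two such vectors, which forces
  \<open>D l \<noteq> 0\<close>.\<close>

lemma transverse_defining_function:
  fixes U :: "'a::euclidean_space set"
  assumes u: "u \<in> manifold_interior (DIM('a) - 1) U" and tr: "transverse_at U L u"
    and L: "L \<subseteq> range (\<lambda>s. u + s *\<^sub>R l)" and l: "norm l = 1"
  obtains W :: "'a set" and h :: "'a \<Rightarrow> real" and D where "open W" "u \<in> W" "continuous_on W h"
    "\<And>x. x \<in> W \<Longrightarrow> h x = 0 \<longleftrightarrow> x \<in> U" "(h has_derivative D) (at u)" "0 < D l"
proof -
  obtain W and h :: "'a \<Rightarrow> real" and D where W: "open W" "u \<in> W" and h: "continuous_on W h"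
    and hU: "\<And>x. x \<in> W \<Longrightarrow> h x = 0 \<longleftrightarrow> x \<in> U"
    and D: "(h has_derivative D) (at u)" "surj D"
    using manifold_interior_defining_function[OF u] by blast
  have lin: "linear D" using D(1) by (rule has_derivative_linear)
  obtain x where x: "D x = 1" using D(2) by (metis surjD)
  obtain v w where x_eq: "x = v + w" and v: "v \<in> tangent_space U u" and w: "w \<in> tangent_space L u"
    using tr unfolding transverse_at_def by blast
  have "D v = 0"
    using tangent_space_kernel[OF v W _ D(1)] hU by blast
  \<comment> \<open>The component of \<open>y - u\<close> orthogonal to \<open>l\<close> vanishes
    for \<open>y\<close> on \<open>L\<close>, so its derivative kills \<open>w\<close>.\<close>
  have "w - (w \<bullet> l) *\<^sub>R l = 0"
  proof (rule tangent_space_kernel[OF w open_UNIV])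
    show "((\<lambda>y. (y - u) - ((y - u) \<bullet> l) *\<^sub>R l) has_derivative (\<lambda>w. w - (w \<bullet> l) *\<^sub>R l)) (at u)"
      by (auto intro!: derivative_eq_intros)
    show "(y - u) - ((y - u) \<bullet> l) *\<^sub>R l = 0" if "y \<in> L \<inter> UNIV" for y
      using that L l by (auto simp: norm_eq_1)
  qed simp
  then have "D w = (w \<bullet> l) * D l"
    by (metis eq_iff_diff_eq_0 lin linear_cmul real_scaleR_def)
  then have "D l \<noteq> 0"
    using x x_eq \<open>D v = 0\<close> by (auto simp: linear_add[OF lin])
  \<comment> \<open>Replacing \<open>h\<close> by its negative keeps the zero set and flips the sign
    of \<open>D l\<close>.\<close>
  then consider "0 < D l" | "0 < - D l" by linarith
  then show ?thesis
  proof cases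
    case 1 then show ?thesis using that W h hU D(1) by blast
  next
    case 2 then show ?thesis
      using that[of W "\<lambda>x. - h x" "\<lambda>x. - D x"] W h hU D(1)
      by (auto intro: continuous_intros has_derivative_minus)
  qed
qed

section \<open>Signs and components along a line\<close>

lemma has_derivative_sign_along:
  fixes h :: "'a::real_normed_vector \<Rightarrow> real"
  assumes D: "(h has_derivative D) (at u)" "0 < D l" and "h u = 0"
  obtains d where "0 < d" "\<And>s. 0 < s \<Longrightarrow> s < d \<Longrightarrow> 0 < h (u + s *\<^sub>R l)"
    "\<And>s. 0 < s \<Longrightarrow> s < d \<Longrightarrow> h (u - s *\<^sub>R l) < 0"
proof -
  have "((\<lambda>s. u + s *\<^sub>R l) has_derivative (\<lambda>s. s *\<^sub>R l)) (at 0)"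
    by (auto intro!: derivative_eq_intros)
  then have "((h \<circ> (\<lambda>s. u + s *\<^sub>R l)) has_derivative D \<circ> (\<lambda>s. s *\<^sub>R l)) (at 0)"
    by (rule diff_chain_at) (simp add: D)
  then have der: "((\<lambda>s. h (u + s *\<^sub>R l)) has_field_derivative D l) (at 0)"
    by (simp add: has_field_derivative_def mult_commute_abs o_def
        linear_cmul[OF has_derivative_linear[OF D(1)]])
  obtain d1 where "0 < d1" "\<forall>s>0. s < d1 \<longrightarrow> h (u + 0 *\<^sub>R l) < h (u + (0 + s) *\<^sub>R l)"
    using DERIV_pos_inc_right[OF der D(2)] by blast
  moreover obtain d2 where "0 < d2" "\<forall>s>0. s < d2 \<longrightarrow> h (u + (0 - s) *\<^sub>R l) < h (u + 0 *\<^sub>R l)"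
    using DERIV_pos_inc_left[OF der D(2)] by blast
  ultimately show ?thesis
    using that[of "min d1 d2"] \<open>h u = 0\<close> by auto
qed

text \<open>The half-line of negative parameters is connected and misses \<open>u\<close>, so it
  lies in a single component. If \<open>b\<close> were negative, \<open>C\<close> and
  \<open>E\<close> would both contain it and hence coincide.\<close>

lemma components_line_minus_point:
  fixes u l :: "'a::real_normed_vector"
  defines "L \<equiv> range (\<lambda>s. u + s *\<^sub>R l)"
  assumes "l \<noteq> 0" and C: "C \<in> components (L - {u})" and E: "E \<in> components (L - {u})" and "C \<noteq> E"
    and a: "u + a *\<^sub>R l \<in> C" "a < 0" and b: "u + b *\<^sub>R l \<in> E"
  shows "0 < b"
proof (rule ccontr)
  assume "\<not> 0 < b"
  moreover have "b \<noteq> 0" using in_components_subset[OF E] b by auto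
  ultimately have "b < 0" by simp
  let ?H = "(\<lambda>s. u + s *\<^sub>R l) ` {..<0}"
  have "connected ?H"
    by (intro connected_continuous_image continuous_intros) (simp add: convex_connected)
  moreover have "?H \<subseteq> L - {u}" using \<open>l \<noteq> 0\<close> unfolding L_def by auto
  moreover have "u + a *\<^sub>R l \<in> C \<inter> ?H" "u + b *\<^sub>R l \<in> E \<inter> ?H" using a b \<open>b < 0\<close> by auto
  ultimately have "?H \<subseteq> C" "?H \<subseteq> E"
    using components_maximal[OF C, of ?H] components_maximal[OF E, of ?H] by auto
  then have "C \<inter> E \<noteq> {}" using a(2) by blast
  then show False using components_nonoverlap[OF C E] \<open>C \<noteq> E\<close> by blast
qed

theorem theorem5p3:
  fixes U \<Omega> L I :: "(real ^ 'n) set" and u p :: "real ^ 'n"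
  assumes "submanifold (CARD('n) - 1) U"
    and "\<Omega> \<subseteq> UNIV - U"
    and "affine L" and "aff_dim L = 1"
    and "u \<in> manifold_interior (CARD('n) - 1) U"
    and "transverse_at U L u"
    and "p \<in> L \<inter> \<Omega>"
    and "open_interval_of L I" and "I \<subseteq> L \<inter> \<Omega>"
    and "\<exists>C\<in>components (L - {u}). \<exists>D\<in>components (L - {u}). C \<noteq> D \<and> p \<in> C \<and> I \<subseteq> D"
  shows "\<exists>f :: real ^ 'n \<Rightarrow> real. locally_convex_fun_on \<Omega> f \<and> \<not> convex_fun_on \<Omega> f"
proof -

  \<comment> \<open>Coordinates along \<open>L\<close>\<close>
  obtain C E where C: "C \<in> components (L - {u})" and E: "E \<in> components (L - {u})"
    and CE: "C \<noteq> E" "p \<in> C" "I \<subseteq> E"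
    using assms(10) by blast
  have "u \<noteq> p" using in_components_subset[OF C] CE by auto
  have uU: "u \<in> U" and uL: "u \<in> L" using assms(6) unfolding transverse_at_def by auto
  \<comment> \<open>The unit vector from \<open>p\<close> towards \<open>u\<close>. With
    \<open>u\<close> as origin, \<open>p\<close> has parameter \<open>- m\<close>, so the points of
    \<open>I\<close> will have positive parameters.\<close>
  define l where "l = (u - p) /\<^sub>R norm (u - p)"
  define m where "m = norm (u - p)"
  have m: "0 < m" and l: "norm l = 1" "l \<bullet> l = 1" "l \<noteq> 0"
    using \<open>u \<noteq> p\<close> by (auto simp: l_def m_def norm_eq_1 dot_square_norm)
  have p: "p = u + (- m) *\<^sub>R l" using \<open>u \<noteq> p\<close> by (simp add: l_def m_def)
  have L: "L = range (\<lambda>s. u + s *\<^sub>R l)"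
  proof -
    have "affine hull {u, p} = L"
      using assms(3,4,7) uL \<open>u \<noteq> p\<close>
      by (intro affine_dim_equal) (auto simp: hull_minimal aff_dim_affine_hull)
    also have "affine hull {u, p} = range (\<lambda>s. u + s *\<^sub>R l)"
    proof safe
      fix x assume "x \<in> affine hull {u, p}"
      then obtain a b where "a + b = 1" "x = a *\<^sub>R u + b *\<^sub>R p" by (auto simp: affine_hull_2)
      then have "x = u + (- m * b) *\<^sub>R l"
        by (simp add: p algebra_simps flip: scaleR_left_distrib)
      then show "x \<in> range (\<lambda>s. u + s *\<^sub>R l)" by blast
    next
      fix s
      have "u + s *\<^sub>R l = (1 + s / m) *\<^sub>R u + (- (s / m)) *\<^sub>R p"
        using m by (simp add: p algebra_simps)
      then show "u + s *\<^sub>R l \<in> affine hull {u, p}"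
        unfolding affine_hull_2 by (smt (verit) mem_Collect_eq)
    qed
    finally show ?thesis by simp
  qed

  \<comment> \<open>The wall and the function \<open>f\<close>\<close>
  obtain W and h :: "real^'n \<Rightarrow> real" and D where W: "open W" "u \<in> W" and h: "continuous_on W h"
    and hU: "\<And>x. x \<in> W \<Longrightarrow> h x = 0 \<longleftrightarrow> x \<in> U"
    and D: "(h has_derivative D) (at u)" "0 < D l"
  proof (rule transverse_defining_function)
    show "u \<in> manifold_interior (DIM(real^'n) - 1) U" using assms(5) by simp
    show "L \<subseteq> range (\<lambda>s. u + s *\<^sub>R l)" using L by simp
  qed (use assms(6) l(1) in auto)
  have "h u = 0" using hU W uU by blast
  then obtain d0 where "0 < d0" and pos: "\<And>s. 0 < s \<Longrightarrow> s < d0 \<Longrightarrow> 0 < h (u + s *\<^sub>R l)"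
    and neg: "\<And>s. 0 < s \<Longrightarrow> s < d0 \<Longrightarrow> h (u - s *\<^sub>R l) < 0"
    using has_derivative_sign_along[OF D] by metis
  obtain e where e: "0 < e" "cball u e \<subseteq> W" using W open_contains_cball by blast
  \<comment> \<open>\<open>d < d0\<close> fixes the signs of \<open>h\<close> on \<open>L\<close> at
    parameters \<open>d\<close> and \<open>- d\<close>. As \<open>r < d\<close> will hold,
    \<open>2 * d \<le> e\<close> puts the box \<open>\<bar>t x\<bar> \<le> d\<close>,
    \<open>q x \<le> r\<close> inside \<open>W\<close>.\<close>
  define d where "d = min d0 e / 2"
  have d: "0 < d" "d < d0" "2 * d \<le> e" using e \<open>0 < d0\<close> by (auto simp: d_def)
  \<comment> \<open>\<open>t\<close> is the signed coordinate along \<open>L\<close>, and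
    \<open>q\<close> the distance to \<open>L\<close>.\<close>
  define t where "t x = (x - u) \<bullet> l" for x
  define q where "q x = norm ((x - u) - t x *\<^sub>R l)" for x
  have t_cont: "isCont t x" for x unfolding t_def by (intro continuous_intros)
  have q_cont: "isCont q x" for x unfolding q_def t_def by (intro continuous_intros)
  have t_line: "t (u + s *\<^sub>R l) = s" and q_line: "q (u + s *\<^sub>R l) = 0" for s
    using l by (auto simp: t_def q_def)
  have dist_line: "dist (u + s *\<^sub>R l) x \<le> q x + \<bar>t x - s\<bar>" for x s
  proof -
    have "dist (u + s *\<^sub>R l) x = norm (((x - u) - t x *\<^sub>R l) + (t x - s) *\<^sub>R l)"
      by (simp add: dist_norm norm_minus_commute algebra_simps)
    also have "\<dots> \<le> q x + norm ((t x - s) *\<^sub>R l)"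
      unfolding q_def by (rule norm_triangle_ineq)
    finally show ?thesis using l by simp
  qed
  have q_convex: "convex_on UNIV q"
  proof (rule convex_onI)
    fix s :: real and x y assume s: "0 < s" "s < 1"
    \<comment> \<open>\<open>q\<close> is the norm of an affine map, hence convex.\<close>
    have "((1 - s) *\<^sub>R x + s *\<^sub>R y - u) - t ((1 - s) *\<^sub>R x + s *\<^sub>R y) *\<^sub>R l =
        (1 - s) *\<^sub>R ((x - u) - t x *\<^sub>R l) + s *\<^sub>R ((y - u) - t y *\<^sub>R l)"
      by (simp add: t_def algebra_simps inner_diff_left inner_add_left)
    then show "q ((1 - s) *\<^sub>R x + s *\<^sub>R y) \<le> (1 - s) * q x + s * q y"
      unfolding q_def using s
      by (metis (no_types, lifting) abs_of_pos diff_gt_0_iff_gt norm_scaleR norm_triangle_ineq)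
  qed simp
  have h_cont: "isCont h x" if "x \<in> W" for x
    using h W(1) that by (simp add: continuous_on_eq_continuous_at)
  have ev: "\<forall>\<^sub>F z in nhds x. a < g z" if "isCont g x" "a < g x"
    for g :: "real^'n \<Rightarrow> real" and a x
    using that by (auto simp: isCont_def tendsto_at_iff_tendsto_nhds dest: order_tendstoD)
  have ev': "\<forall>\<^sub>F z in nhds x. g z < a" if "isCont g x" "g x < a"
    for g :: "real^'n \<Rightarrow> real" and a x
    using that by (auto simp: isCont_def tendsto_at_iff_tendsto_nhds dest: order_tendstoD)
  have W_line: "u + s *\<^sub>R l \<in> W" if "\<bar>s\<bar> \<le> d" for s
    using that d e l by (intro subsetD[OF e(2)]) (simp add: dist_norm)
  have "isCont h (u + d *\<^sub>R l)" "isCont h (u - d *\<^sub>R l)"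
    using d h_cont[OF W_line[of d]] h_cont[OF W_line[of "-d"]] by auto
  then have "\<forall>\<^sub>F x in nhds (u + d *\<^sub>R l). 0 < h x" "\<forall>\<^sub>F x in nhds (u - d *\<^sub>R l). h x < 0"
    using pos neg d by (auto intro: ev ev')
  then obtain r1 r2 where r1: "0 < r1" "\<And>x. dist x (u + d *\<^sub>R l) < r1 \<Longrightarrow> 0 < h x"
    and r2: "0 < r2" "\<And>x. dist x (u - d *\<^sub>R l) < r2 \<Longrightarrow> h x < 0"
    unfolding eventually_nhds_metric by metis
  \<comment> \<open>The end discs of the box, at \<open>t x = d\<close> and
    \<open>t x = - d\<close>, now lie in the balls where \<open>h\<close> has a fixed sign, so the
    zeros of \<open>h\<close> in the box avoid both ends.\<close>
  define r where "r = min d (min r1 r2) / 2"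
  have r: "0 < r" "r < d" "r < r1" "r < r2" using d r1 r2 by (auto simp: r_def)
  have top: "0 < h x" if "q x \<le> r" "t x = d" for x
    using that r dist_line[of d x] by (intro r1) (simp add: dist_commute)
  have bot: "h x < 0" if "q x \<le> r" "t x = - d" for x
    using that r dist_line[of "-d" x] by (intro r2) (simp add: dist_commute)
  have box: "x \<in> W" if "q x \<le> r" "\<bar>t x\<bar> \<le> d" for x
    using that r d dist_line[of 0 x] by (intro subsetD[OF e(2)]) simp
  \<comment> \<open>The side of \<open>I\<close>. Since \<open>h\<close> is controlled only on
    \<open>W\<close>, its sign decides only between heights \<open>- d\<close> and \<open>d\<close>;
    beyond these \<open>t\<close> alone decides.\<close>
  define P where "P x \<longleftrightarrow> d \<le> t x \<or> - d < t x \<and> 0 < h x" for x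
  define f where "f x = (if q x \<le> r \<and> P x then r else q x)" for x

  \<comment> \<open>Local convexity\<close>
  have "locally_convex_fun_on \<Omega> f"
    unfolding locally_convex_fun_on_def
  proof
    fix x assume "x \<in> \<Omega>"
    then have "x \<notin> U" using assms(2) by blast
    \<comment> \<open>Where \<open>r < q z\<close>, the functions \<open>f\<close>, \<open>q\<close>
      and \<open>max q r\<close> agree, so \<open>P\<close> only has to be locally constant on the
      cylinder.\<close>
    have "(\<forall>\<^sub>F z in nhds x. r < q z \<or> P z) \<or> (\<forall>\<^sub>F z in nhds x. r < q z \<or> \<not> P z)"
    proof -
      consider "r < q x" | "d < t x" | "t x < - d" | "q x \<le> r" "\<bar>t x\<bar> \<le> d" by linarith
      then show ?thesis
      proof cases
        case 1
        show ?thesis by (intro disjI1[OF eventually_mono[OF ev[OF q_cont 1]]]) simp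
      next
        case 2
        show ?thesis by (intro disjI1[OF eventually_mono[OF ev[OF t_cont 2]]]) (simp add: P_def)
      next
        case 3
        show ?thesis by (intro disjI2[OF eventually_mono[OF ev'[OF t_cont 3]]]) (use d in \<open>simp add: P_def\<close>)
      next
        case 4
        then have xW: "x \<in> W" by (rule box)
        \<comment> \<open>In \<open>W\<close> the zeros of \<open>h\<close> are exactly the points
          of \<open>U\<close>, so at \<open>x\<close> the sign is strict and persists
          nearby.\<close>
        then consider "0 < h x" | "h x < 0" using hU \<open>x \<notin> U\<close> by force
        then show ?thesis
        proof cases
          case 1
          \<comment> \<open>\<open>bot\<close> excludes the lower end disc, so the second disjunct
            of \<open>P\<close> holds near \<open>x\<close>.\<close>
          then have "- d < t x" using bot[of x] 4 by force
          then have "\<forall>\<^sub>F z in nhds x. - d < t z \<and> 0 < h z"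
            using 1 ev[OF t_cont] ev[OF h_cont[OF xW]] by (intro eventually_conj)
          then show ?thesis by (intro disjI1) (auto elim: eventually_mono simp: P_def)
        next
          case 2
          \<comment> \<open>Dually, \<open>top\<close> excludes the upper end disc, so both
            disjuncts of \<open>P\<close> fail near \<open>x\<close>.\<close>
          then have "t x < d" using top[of x] 4 by force
          then have "\<forall>\<^sub>F z in nhds x. t z < d \<and> h z < 0"
            using 2 ev'[OF t_cont] ev'[OF h_cont[OF xW]] by (intro eventually_conj)
          then show ?thesis by (intro disjI2) (auto elim: eventually_mono simp: P_def)
        qed
      qed
    qed
    then have "\<exists>g. convex_on UNIV g \<and> (\<forall>\<^sub>F z in nhds x. f z = g z)"
    proof
      assume "\<forall>\<^sub>F z in nhds x. r < q z \<or> P z"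
      then have "\<forall>\<^sub>F z in nhds x. f z = max (q z) r"
        by eventually_elim (auto simp: f_def)
      moreover have "convex_on UNIV (\<lambda>z. max (q z) r)"
        by (intro convex_on_max q_convex) (simp add: convex_on_const)
      ultimately show ?thesis by blast
    next
      assume "\<forall>\<^sub>F z in nhds x. r < q z \<or> \<not> P z"
      then have "\<forall>\<^sub>F z in nhds x. f z = q z"
        by eventually_elim (auto simp: f_def)
      then show ?thesis using q_convex by blast
    qed
    then obtain g \<rho> where "convex_on UNIV g" "0 < \<rho>" "\<And>z. dist z x < \<rho> \<Longrightarrow> f z = g z"
      unfolding eventually_nhds_metric by metis
    then show "\<exists>\<rho>>0. convex_fun_on (ball x \<rho> \<inter> \<Omega>) f"
      by (intro exI[of _ \<rho>] conjI convex_fun_on_cong_convex_on[of g]) (auto simp: dist_commute)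
  qed

  \<comment> \<open>Failure of convexity\<close>
  moreover have "\<not> convex_fun_on \<Omega> f"
  proof
    assume f: "convex_fun_on \<Omega> f"
    have upper: "f (u + s *\<^sub>R l) = r" if "0 < s" for s
      using that pos d r by (cases "s < d") (auto simp: f_def P_def q_line t_line)
    have "f p = 0"
    proof -
      have "t p = - m" "q p = 0" unfolding p by (rule t_line, rule q_line)
      \<comment> \<open>\<open>P p\<close> fails in either case: by the sign of \<open>h\<close> if
        \<open>m < d\<close>, and by \<open>t p \<le> - d\<close> otherwise.\<close>
      moreover have "h p < 0" if "m < d" using that neg[of m] m d by (simp add: p)
      ultimately show ?thesis using m d by (auto simp: f_def P_def)
    qed
    obtain a b where "a \<noteq> b" and I: "I = open_segment a b"
      using assms(8) unfolding open_interval_of_def by blast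
    \<comment> \<open>Two points of \<open>I\<close> are needed: convexity is tested at the one
      nearer to \<open>u\<close>, which lies between \<open>p\<close> and the other. All three
      points lie in \<open>\<Omega>\<close>, whereas \<open>u\<close> does not.\<close>
    then have "infinite I" by simp
    then obtain x y where xy: "x \<in> I" "y \<in> I" "x \<noteq> y"
      by (metis finite.emptyI finite_insert finite_subset insertI1 subsetI)
    have I_pos: "\<exists>s>0. z = u + s *\<^sub>R l" if z: "z \<in> I" for z
    proof -
      obtain s where s: "z = u + s *\<^sub>R l" using z assms(9) L by blast
      have "0 < s"
        using components_line_minus_point[of l C u E "-m" s] C E CE l(3) m p s z
        unfolding L by auto
      then show ?thesis using s by blast
    qed
    obtain s1 s2 where s: "0 < s1" "s1 < s2" and I12: "u + s1 *\<^sub>R l \<in> I" "u + s2 *\<^sub>R l \<in> I"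
      using I_pos xy by (metis linorder_less_linear)
    \<comment> \<open>The weight that expresses parameter \<open>s1\<close> as a convex combination
      of \<open>- m\<close> and \<open>s2\<close>.\<close>
    define c where "c = (s1 + m) / (s2 + m)"
    have c: "0 \<le> c" "c < 1" using s m by (auto simp: c_def)
    have "c * (s2 + m) = s1 + m" using s m by (simp add: c_def)
    then have "c * s2 - (1 - c) * m = s1" by (simp add: algebra_simps)
    then have comb: "(1 - c) *\<^sub>R p + c *\<^sub>R (u + s2 *\<^sub>R l) = u + s1 *\<^sub>R l"
      by (simp add: p algebra_simps flip: scaleR_left_distrib)
    \<comment> \<open>\<open>f\<close> is 0 at \<open>p\<close> and \<open>r\<close> at both points
      of \<open>I\<close>; this contradicts \<open>c < 1\<close>.\<close>
    have "r \<le> c * r"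
      using convex_fun_onD[OF f, of p "u + s2 *\<^sub>R l" c] c comb I12 assms(7,9) upper s \<open>f p = 0\<close>
      by (auto simp: subset_iff)
    then show False using c r by simp
  qed
  ultimately show ?thesis by blast
qed

end
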